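(* Let the network, weight matrix $W$ and functions $f_1,\dots,f_N$ satisfy assumptions A1, A2, A3 of the context, let $\beta>0$, $\gamma_0>0$, and let $\{\mathbf x^k\}$ be a sequence generated by DINAS (see context), $\mathbf g^k=\nabla\Phi_\beta(\mathbf x^k)$, and $\mathbf x^*$ the unique minimizer of $\Phi_\beta$. (a) If $\{\eta_k\}$ is a nonincreasing sequence such that $\eta_k\le\bar\eta$ for all $k$, with $\bar\eta>0$ small enough (i.e. smaller than some positive threshold determined by the problem), then $\{\mathbf x^k\}$ converges linearly to $\mathbf x^*$ in the norm $\|\cdot\|_\infty$. (b) If $\eta_k\le\eta\|\mathbf g^k\|_\infty^\delta$ for some $\eta\ge0$ and all $k$ large enough, then the convergence of $\{\mathbf x^k\}$ to $\mathbf x^*$ is superlinear for $\delta\in(0,1)$ and quadratic for $\delta=1$.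
   Context: Assumptions. A1: $\mathcal G=(\mathcal V,\mathcal E)$ is an undirected, simple, connected graph on nodes $1,\dots,N$, with self-loops at every node ($(i,i)\in\mathcal E$ for all $i$). A2: $W=[w_{ij}]\in\mathbb R^{N\times N}$ is symmetric and doubly stochastic (nonnegative entries, rows and columns sum to 1), $w_{ij}=0$ if $(i,j)\notin\mathcal E$, $w_{ij}\neq0$ if $(i,j)\in\mathcal E$, and $w_{ii}\ne0$ for all $i$. A3: each $f_i:\mathbb R^n\to\mathbb R$ is twice continuously differentiable and strongly convex, and there are constants $0<\mu<M$ and $L>0$ such that for all $i$ and all $y,z\in\mathbb R^n$: $\mu I\prec\nabla^2f_i(y)\prec MI$ (where $A\prec B$ means that $B-A$ is positive definite) and $\|\nabla^2f_i(y)-\nabla^2f_i(z)\|_\infty\le L\|y-z\|_\infty$. Here $\|\cdot\|_\infty$ is the max norm on vectors and the induced operator norm on matrices. Problem. For $\mathbf x=(\mathbf x_1,\dots,\mathbf x_N)\in\mathbb R^{nN}$, $\mathbf x_i\in\mathbb R^n$, let $F(\mathbf x)=\sum_{i=1}^Nf_i(\mathbf x_i)$, $\mathcal W=W\otimes I_n$, and for $\beta>0$ let $\Phi_\beta(\mathbf x)=F(\mathbf x)+\frac1{2\beta}\mathbf x^\top(I-\mathcal W)\mathbf x$. DINAS. Inputs: $\mathbf x^0\in\mathbb R^{nN}$, $\gamma_0>0$, $q\in(0,1)$, forcing terms $\eta_k$ with $0\le\eta_k\le\eta_{\max}<1$ for a constant $\eta_{\max}$ (standing requirement). Write $\mathbf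 g^k=\nabla\Phi_\beta(\mathbf x^k)$, $H^k=\nabla^2\Phi_\beta(\mathbf x^k)$. At iteration $k$: (1) a direction $\mathbf d^k$ is computed with $\|H^k\mathbf d^k-\mathbf g^k\|_\infty\le\eta_k\|\mathbf g^k\|_\infty$ (by an iterative linear solver); (2) set $\alpha_k=\min\left\{1,\frac{1-\eta_k}{(1+\eta_k)^2}\gamma_k\frac1{\|\mathbf g^k\|_\infty}\right\}$ (equal to $1$ if $\mathbf g^k=0$), $\hat{\mathbf x}=\mathbf x^k-\alpha_k\mathbf d^k$, $\hat{\mathbf g}=\nabla\Phi_\beta(\hat{\mathbf x})$; (3) check whether one of the following holds: (C1) $\alpha_k<1$ and $\|\hat{\mathbf g}\|_\infty\le\|\mathbf g^k\|_\infty-\frac12\frac{(1-\eta_k)^2}{(1+\eta_k)^2}\gamma_k$; (C2) $\alpha_k=1$ and $\|\hat{\mathbf g}\|_\infty\le\eta_k\|\mathbf g^k\|_\infty+\frac1{2\gamma_k}(1+\eta_k)^2\|\mathbf g^k\|_\infty^2$. If (C1) or (C2) holds, set $\gamma_{k+1}=\gamma_k$, $\mathbf x^{k+1}=\hat{\mathbf x}$ and go to iteration $k+1$; otherwise replace $\gamma_k$ by $q\gamma_k$ and repeat from (2) with the same $\mathbf d^k$. Rates. With $e_k=\|\mathbf x^k-\mathbf x^*\|_\infty\to0$: linear means there is $c\in(0,1)$ with $e_{k+1}\le c\,e_k$ for all large $k$; superlinear means $e_{k+1}\le c_ke_k$ for all large $k$ with $c_k\to0$; quadratic means there is $c>0$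 with $e_{k+1}\le c\,e_k^2$ for all large $k$. *)

theory Defs
  imports "HOL-Analysis.Analysis"
begin

section \<open>Derivatives, definiteness and norms\<close>

definition grad :: "(real^'k \<Rightarrow> real) \<Rightarrow> real^'k \<Rightarrow> real^'k" where
  "grad f x = (THE D. GDERIV f x :> D)"

definition hess :: "(real^'k \<Rightarrow> real) \<Rightarrow> real^'k \<Rightarrow> real^'k^'k" where
  "hess f x = jacobian (grad f) (at x)"

definition twice_continuously_differentiable :: "(real^'k \<Rightarrow> real) \<Rightarrow> bool" where
  "twice_continuously_differentiable f \<longleftrightarrow>
     (\<forall>x. f differentiable (at x)) \<and>
     (\<forall>x. grad f differentiable (at x)) \<and>
     continuous_on UNIV (hess f)"

definition strongly_convex :: "(real^'k \<Rightarrow> real) \<Rightarrow> bool" where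
  "strongly_convex f \<longleftrightarrow> (\<exists>m>0. convex_on UNIV (\<lambda>x. f x - m / 2 * (norm x)\<^sup>2))"

text \<open>Symmetry is part of positive definiteness. It restricts nothing when the matrix is
  built from the Hessian of a twice continuously differentiable function.\<close>

definition positive_definite :: "real^'k^'k \<Rightarrow> bool" where
  "positive_definite A \<longleftrightarrow> transpose A = A \<and> (\<forall>v. v \<noteq> 0 \<longrightarrow> 0 < v \<bullet> (A *v v))"

definition loewner_less :: "real^'k^'k \<Rightarrow> real^'k^'k \<Rightarrow> bool" where
  "loewner_less A B \<longleftrightarrow> positive_definite (B - A)"

text \<open>The max norm on vectors is the library's \<^const>\<open>infnorm\<close>. The operator norm it induces
  on matrices is defined like \<^const>\<open>onorm\<close>; the quotient at \<open>v = 0\<close> is \<open>0\<close>.\<close>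

definition op_infnorm :: "real^'k^'k \<Rightarrow> real" where
  "op_infnorm A = (SUP v. infnorm (A *v v) / infnorm v)"


section \<open>Network, weight matrix and local costs\<close>

text \<open>The nodes are the elements of the finite type \<open>'N\<close>. An edge relation that is a set of
  pairs has no multiple edges; undirectedness is symmetry, and every node has a self-loop.\<close>

definition network :: "('N::finite \<times> 'N) set \<Rightarrow> bool" where
  "network E \<longleftrightarrow> sym E \<and> (\<forall>i. (i, i) \<in> E) \<and> (\<forall>i j. (i, j) \<in> E\<^sup>*)"

definition doubly_stochastic :: "real^'N^'N \<Rightarrow> bool" where
  "doubly_stochastic W \<longleftrightarrow>
     (\<forall>i j. 0 \<le> W $ i $ j) \<and> (\<forall>i. (\<Sum>j\<in>UNIV. W $ i $ j) = 1) \<and> (\<forall>j. (\<Sum>i\<in>UNIV. W $ i $ j) = 1)"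

definition weight_matrix :: "('N::finite \<times> 'N) set \<Rightarrow> real^'N^'N \<Rightarrow> bool" where
  "weight_matrix E W \<longleftrightarrow>
     transpose W = W \<and> doubly_stochastic W \<and>
     (\<forall>i j. (i, j) \<notin> E \<longrightarrow> W $ i $ j = 0) \<and>
     (\<forall>i j. (i, j) \<in> E \<longrightarrow> W $ i $ j \<noteq> 0) \<and>
     (\<forall>i. W $ i $ i \<noteq> 0)"

definition regular_costs ::
  "('N::finite \<Rightarrow> real^'n \<Rightarrow> real) \<Rightarrow> real \<Rightarrow> real \<Rightarrow> real \<Rightarrow> bool" where
  "regular_costs f \<mu> M L \<longleftrightarrow>
     0 < \<mu> \<and> \<mu> < M \<and> 0 < L \<and>
     (\<forall>i. twice_continuously_differentiable (f i) \<and> strongly_convex (f i)) \<and>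
     (\<forall>i y. loewner_less (mat \<mu>) (hess (f i) y) \<and> loewner_less (hess (f i) y) (mat M)) \<and>
     (\<forall>i y z. op_infnorm (hess (f i) y - hess (f i) z) \<le> L * infnorm (y - z))"


section \<open>The penalty problem\<close>

text \<open>The stacked space of dimension \<open>nN\<close> is \<open>real^('N \<times> 'n)\<close>: coordinate \<open>(i, a)\<close> is
  component \<open>a\<close> of the block of node \<open>i\<close>.\<close>

definition block :: "real^('N::finite \<times> 'n::finite) \<Rightarrow> 'N \<Rightarrow> real^'n" where
  "block x i = (\<chi> a. x $ (i, a))"

definition kron :: "real^'N::finite^'N \<Rightarrow> real^'n::finite^'n \<Rightarrow> real^('N \<times> 'n)^('N \<times> 'n)" where
  "kron A B = (\<chi> p q. A $ fst p $ fst q * B $ snd p $ snd q)"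

definition total_cost :: "('N::finite \<Rightarrow> real^'n::finite \<Rightarrow> real) \<Rightarrow> real^('N \<times> 'n) \<Rightarrow> real" where
  "total_cost f x = (\<Sum>i\<in>UNIV. f i (block x i))"

definition penalty ::
  "('N::finite \<Rightarrow> real^'n::finite \<Rightarrow> real) \<Rightarrow> real^'N^'N \<Rightarrow> real \<Rightarrow> real^('N \<times> 'n) \<Rightarrow> real" where
  "penalty f W \<beta> x =
     total_cost f x + 1 / (2 * \<beta>) * (x \<bullet> ((mat 1 - kron W (mat 1)) *v x))"

definition unique_minimizer :: "('a \<Rightarrow> real) \<Rightarrow> 'a \<Rightarrow> bool" where
  "unique_minimizer \<Phi> xs \<longleftrightarrow>
     is_arg_min \<Phi> (\<lambda>_. True) xs \<and> (\<forall>y. is_arg_min \<Phi> (\<lambda>_. True) y \<longrightarrow> y = xs)"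


section \<open>The algorithm DINAS\<close>

text \<open>Below, \<open>e\<close> is the current forcing term, \<open>\<gamma>\<close> the current step parameter, \<open>x\<close> the current
  iterate and \<open>d\<close> the current direction.\<close>

definition step_length :: "(real^'k \<Rightarrow> real) \<Rightarrow> real \<Rightarrow> real \<Rightarrow> real^'k \<Rightarrow> real" where
  "step_length \<Phi> e \<gamma> x =
     (if grad \<Phi> x = 0 then 1
      else min 1 ((1 - e) / (1 + e)\<^sup>2 * \<gamma> * (1 / infnorm (grad \<Phi> x))))"

definition trial_point ::
  "(real^'k \<Rightarrow> real) \<Rightarrow> real \<Rightarrow> real \<Rightarrow> real^'k \<Rightarrow> real^'k \<Rightarrow> real^'k" where
  "trial_point \<Phi> e \<gamma> x d = x - step_length \<Phi> e \<gamma> x *\<^sub>R d"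

definition accepted ::
  "(real^'k \<Rightarrow> real) \<Rightarrow> real \<Rightarrow> real \<Rightarrow> real^'k \<Rightarrow> real^'k \<Rightarrow> bool" where
  "accepted \<Phi> e \<gamma> x d \<longleftrightarrow>
     (step_length \<Phi> e \<gamma> x < 1 \<and>
      infnorm (grad \<Phi> (trial_point \<Phi> e \<gamma> x d))
        \<le> infnorm (grad \<Phi> x) - 1 / 2 * ((1 - e)\<^sup>2 / (1 + e)\<^sup>2) * \<gamma>)
     \<or>
     (step_length \<Phi> e \<gamma> x = 1 \<and>
      infnorm (grad \<Phi> (trial_point \<Phi> e \<gamma> x d))
        \<le> e * infnorm (grad \<Phi> x) + 1 / (2 * \<gamma>) * (1 + e)\<^sup>2 * (infnorm (grad \<Phi> x))\<^sup>2)"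

text \<open>In iteration \<open>k\<close> the parameter \<open>\<gamma> k\<close> is the one on entry. The trial with \<open>q ^ j * \<gamma> k\<close> is
  the first one to be accepted, after \<open>j\<close> rejections with the same direction \<open>d k\<close>. The
  directions are any vectors satisfying the residual bound.\<close>

definition dinas ::
  "(real^'k \<Rightarrow> real) \<Rightarrow> real \<Rightarrow> real \<Rightarrow> (nat \<Rightarrow> real) \<Rightarrow> (nat \<Rightarrow> real^'k) \<Rightarrow> bool" where
  "dinas \<Phi> \<gamma>\<^sub>0 q \<eta> x \<longleftrightarrow>
     0 < \<gamma>\<^sub>0 \<and> 0 < q \<and> q < 1 \<and>
     (\<exists>\<eta>\<^sub>m\<^sub>a\<^sub>x<1. \<forall>k. 0 \<le> \<eta> k \<and> \<eta> k \<le> \<eta>\<^sub>m\<^sub>a\<^sub>x) \<and>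
     (\<exists>d \<gamma>. \<gamma> 0 = \<gamma>\<^sub>0 \<and>
        (\<forall>k. infnorm (hess \<Phi> (x k) *v d k - grad \<Phi> (x k)) \<le> \<eta> k * infnorm (grad \<Phi> (x k)) \<and>
             (\<exists>j. accepted \<Phi> (\<eta> k) (q ^ j * \<gamma> k) (x k) (d k) \<and>
                  (\<forall>i<j. \<not> accepted \<Phi> (\<eta> k) (q ^ i * \<gamma> k) (x k) (d k)) \<and>
                  \<gamma> (Suc k) = q ^ j * \<gamma> k \<and>
                  x (Suc k) = trial_point \<Phi> (\<eta> k) (q ^ j * \<gamma> k) (x k) (d k))))"


section \<open>Rates of convergence in the max norm\<close>

definition converges_linearly :: "(nat \<Rightarrow> real^'k) \<Rightarrow> real^'k \<Rightarrow> bool" where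
  "converges_linearly x xs \<longleftrightarrow>
     (\<lambda>k. infnorm (x k - xs)) \<longlonglongrightarrow> 0 \<and>
     (\<exists>c. 0 < c \<and> c < 1 \<and>
        (\<forall>\<^sub>F k in sequentially. infnorm (x (Suc k) - xs) \<le> c * infnorm (x k - xs)))"

definition converges_superlinearly :: "(nat \<Rightarrow> real^'k) \<Rightarrow> real^'k \<Rightarrow> bool" where
  "converges_superlinearly x xs \<longleftrightarrow>
     (\<lambda>k. infnorm (x k - xs)) \<longlonglongrightarrow> 0 \<and>
     (\<exists>c. c \<longlonglongrightarrow> 0 \<and>
        (\<forall>\<^sub>F k in sequentially. infnorm (x (Suc k) - xs) \<le> c k * infnorm (x k - xs)))"

definition converges_quadratically :: "(nat \<Rightarrow> real^'k) \<Rightarrow> real^'k \<Rightarrow> bool" where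
  "converges_quadratically x xs \<longleftrightarrow>
     (\<lambda>k. infnorm (x k - xs)) \<longlonglongrightarrow> 0 \<and>
     (\<exists>c>0. \<forall>\<^sub>F k in sequentially. infnorm (x (Suc k) - xs) \<le> c * (infnorm (x k - xs))\<^sup>2)"

end

theory Submission
  imports Defs
begin

text \<open>The penalty function \<open>\<Phi>\<close> inherits from the local costs two properties that carry the whole
  proof. Its Hessian satisfies \<open>\<mu> * (norm v)\<^sup>2 \<le> v \<bullet> (hess \<Phi> x *v v)\<close>, since the weight matrix
  is symmetric and doubly stochastic and so the consensus term has a positive semidefinite
  Hessian. Its Hessian is also \<open>L\<close>-Lipschitz for the max norm: the Hessian of \<open>F\<close> is block
  diagonal, and that of the consensus term is constant
  (\<open>penalty_smooth_strongly_convex\<close>). From there on the block structure is forgotten.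

  The first property bounds the inverse Hessian by a constant \<open>\<kappa>\<close> in the max norm. With a
  Taylor estimate for the gradient, a damped inexact Newton step of length \<open>a\<close> gives
  \<open>G' \<le> (1 - a * (1 - e)) * G + L * \<kappa>\<^sup>2 / 2 * (a * (1 + e) * G)\<^sup>2\<close>, where \<open>G\<close> and \<open>G'\<close> are the
  max norms of the old and the new gradient. The step length and the two acceptance tests of
  DINAS are made so that this estimate passes as soon as \<open>\<gamma> \<le> 1 / (L * \<kappa>\<^sup>2)\<close>
  (\<open>accepted_if_small\<close>). Backtracking therefore never pushes \<open>\<gamma>\<close> below a positive bound.

  Hence an accepted short step lowers the max norm of the gradient by a fixed amount, and an
  accepted full step multiplies it by a factor below \<open>1\<close>. The former can happen only finitely
  often, so the gradients tend to \<open>0\<close> and all late steps are full steps (\<open>dinas_gradients\<close>).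
  Near the minimizer the gradient and the error are comparable, so the acceptance test of full
  steps becomes a recursion for the error \<open>e\<^sub>k\<close>, with a problem constant \<open>C\<close> and with \<open>b\<close>
  depending on the run: \<open>e\<^sub>k\<^sub>+\<^sub>1 \<le> (\<kappa> * C * \<eta>\<^sub>k + b * e\<^sub>k) * e\<^sub>k\<close> (\<open>dinas_errors\<close>).
  Since \<open>e\<^sub>k\<close> tends to \<open>0\<close>, the forcing terms alone decide the rate: the bracket ends below \<open>1\<close>
  if they are small, tends to \<open>0\<close> if they do, and is of order \<open>e\<^sub>k\<close> if they are.\<close>

section \<open>The max norm, gradients and Hessians\<close>

lemma infnorm_le_cartI:
  fixes x :: "real^'k"
  assumes "\<And>i. \<bar>x $ i\<bar> \<le> b"
  shows "infnorm x \<le> b"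
  unfolding infnorm_cart by (rule cSup_least) (use assms in auto)

text \<open>The supremum in \<^const>\<open>op_infnorm\<close> is meaningful only because the quotients are bounded,
  which follows from the equivalence of the max norm and the Euclidean norm.\<close>
lemma infnorm_mult_vec_le_op_infnorm:
  fixes A :: "real^'k^'k"
  shows "infnorm (A *v v) \<le> op_infnorm A * infnorm v"
proof (cases "v = 0")
  case False
  define B where "B = onorm ((*v) A) * sqrt CARD('k)"
  have B: "infnorm (A *v v) \<le> B * infnorm v" for v
  proof -
    have "infnorm (A *v v) \<le> onorm ((*v) A) * norm v"
      by (intro order_trans[OF infnorm_le_norm] onorm matrix_vector_mul_bounded_linear)
    also have "\<dots> \<le> onorm ((*v) A) * (sqrt CARD('k) * infnorm v)"
      using norm_le_infnorm[of v]
      by (intro mult_left_mono onorm_pos_le matrix_vector_mul_bounded_linear) simp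
    finally show ?thesis by (simp add: B_def)
  qed
  have "0 \<le> B" unfolding B_def
    by (intro mult_nonneg_nonneg onorm_pos_le matrix_vector_mul_bounded_linear) simp
  then have "infnorm (A *v u) / infnorm u \<le> B" for u
    using B[of u] infnorm_pos_lt[of u] by (cases "u = 0") (auto simp: field_simps infnorm_0)
  then have "infnorm (A *v v) / infnorm v \<le> op_infnorm A"
    unfolding op_infnorm_def by (intro cSUP_upper bdd_aboveI2[where M = B]) auto
  with False show ?thesis by (simp add: pos_divide_le_eq infnorm_pos_lt)
qed (simp add: infnorm_0)

text \<open>Definiteness speaks about the Euclidean norm and DINAS about the max norm; passing from one to
  the other costs the factor \<open>sqrt CARD('k)\<close>. With \<open>w\<close> a Hessian applied to \<open>v\<close> this bounds the
  inverse Hessian, with \<open>w\<close> a difference of gradients it bounds the error by the gradient.\<close>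
lemma infnorm_le_of_strong_monotonicity:
  fixes v w :: "real^'k"
  assumes mu: "0 < \<mu>" and le: "\<mu> * (norm v)\<^sup>2 \<le> v \<bullet> w"
  shows "infnorm v \<le> sqrt CARD('k) / \<mu> * infnorm w"
proof -
  have "\<mu> * norm v \<le> norm w"
  proof (cases "v = 0")
    case False
    have "(\<mu> * norm v) * norm v \<le> norm w * norm v"
      using le norm_cauchy_schwarz[of v w] by (simp add: power2_eq_square mult_ac)
    with False show ?thesis by simp
  qed simp
  also have "\<dots> \<le> sqrt CARD('k) * infnorm w"
    using norm_le_infnorm[of w] by simp
  finally have "\<mu> * infnorm v \<le> sqrt CARD('k) * infnorm w"
    using infnorm_le_norm[of v] mu by (smt (verit) mult_left_mono)
  with mu show ?thesis by (simp add: field_simps)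
qed

lemma GDERIV_unique:
  fixes f :: "real^'k \<Rightarrow> real"
  assumes "GDERIV f x :> D" "GDERIV f x :> D'"
  shows "D = D'"
proof -
  have "(\<lambda>h. h \<bullet> D) = (\<lambda>h. h \<bullet> D')"
    using assms unfolding gderiv_def by (rule has_derivative_unique)
  then have "h \<bullet> D = h \<bullet> D'" for h by meson
  then show ?thesis using vector_eq_ldot by blast
qed

lemma grad_eqI: "GDERIV f x :> D \<Longrightarrow> grad f x = D"
  unfolding grad_def by (blast intro: GDERIV_unique)

lemma differentiable_imp_GDERIV_grad:
  fixes f :: "real^'k \<Rightarrow> real"
  assumes "f differentiable (at x)"
  shows "GDERIV f x :> grad f x"
proof -
  from assms obtain f' where f': "(f has_derivative f') (at x)"
    by (auto simp: differentiable_def)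
  have "f' = (\<lambda>h. h \<bullet> adjoint f' 1)"
    using adjoint_works[OF has_derivative_linear[OF f'], of _ 1] by (auto simp: fun_eq_iff)
  with f' have "GDERIV f x :> adjoint f' 1" by (simp add: gderiv_def)
  then show ?thesis using grad_eqI by metis
qed

lemma twice_continuously_differentiable_hess:
  assumes "twice_continuously_differentiable f"
  shows "(grad f has_derivative (\<lambda>h. hess f x *v h)) (at x)"
  using assms by (simp add: twice_continuously_differentiable_def hess_def jacobian_works)

section \<open>Sequences that drop or contract\<close>

text \<open>A nonnegative decreasing sequence has consecutive differences tending to \<open>0\<close>, so drops by a
  fixed amount must stop. The predicate \<open>P\<close> carries along whatever else is known about the
  indices at which the sequence contracts.\<close>
lemma real_seq_drop_or_contract:
  fixes G :: "nat \<Rightarrow> real"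
  assumes nonneg: "\<And>k. 0 \<le> G k" and c: "0 < c" and r: "0 \<le> r" "r < 1"
    and step: "\<And>k. G (Suc k) \<le> G k - c \<or> (G (Suc k) \<le> r * G k \<and> P k)"
  shows "G \<longlonglongrightarrow> 0" and "eventually P sequentially"
proof -
  have dec: "G (Suc k) \<le> G k" for k
  proof -
    have "r * G k \<le> 1 * G k"
      using r nonneg by (intro mult_right_mono) auto
    then show ?thesis using step[of k] c by auto
  qed
  then have "decseq G" by (simp add: decseq_SucI)
  then obtain l where l: "G \<longlonglongrightarrow> l"
    using nonneg decseq_convergent[of G 0] by blast
  have "(\<lambda>k. G k - G (Suc k)) \<longlonglongrightarrow> l - l"
    by (intro tendsto_diff l LIMSEQ_Suc)
  then have "eventually (\<lambda>k. G k - G (Suc k) < c) sequentially"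
    using c by (intro order_tendstoD) auto
  then have ev: "eventually (\<lambda>k. G (Suc k) \<le> r * G k \<and> P k) sequentially"
    by eventually_elim (use step in force)
  then show "eventually P sequentially" by eventually_elim simp
  have "l \<le> r * l"
    by (rule tendsto_le[OF _ tendsto_mult[OF tendsto_const l] LIMSEQ_Suc[OF l]])
       (use ev in \<open>auto elim: eventually_mono\<close>)
  moreover have "0 \<le> l" using l nonneg by (intro LIMSEQ_le_const) auto
  ultimately have "l = 0"
    using r by (smt (verit) mult_le_cancel_right1)
  with l show "G \<longlonglongrightarrow> 0" by simp
qed

section \<open>Strongly convex functions with Lipschitz Hessian\<close>

text \<open>The properties of the penalty function on which the convergence of DINAS rests.\<close>
locale smooth_strongly_convex =
  fixes \<Phi> :: "real^'k \<Rightarrow> real" and \<mu> L :: real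
  assumes mu_pos: "0 < \<mu>" and L_pos: "0 < L"
    and grad_derivative: "GDERIV \<Phi> x :> grad \<Phi> x"
    and hess_derivative: "(grad \<Phi> has_derivative (\<lambda>h. hess \<Phi> x *v h)) (at x)"
    and hess_ge: "\<mu> * (norm v)\<^sup>2 \<le> v \<bullet> (hess \<Phi> x *v v)"
    and hess_lipschitz:
      "infnorm (hess \<Phi> x *v v - hess \<Phi> y *v v) \<le> L * infnorm (x - y) * infnorm v"
begin

text \<open>A bound for the inverse of every Hessian in the operator norm induced by the max norm.\<close>
definition "\<kappa> = sqrt CARD('k) / \<mu>"

lemma kappa_pos: "0 < \<kappa>"
  using mu_pos by (simp add: \<kappa>_def)

lemma grad_along_line:
  "((\<lambda>t. u \<bullet> grad \<Phi> (x + t *\<^sub>R v)) has_real_derivative u \<bullet> (hess \<Phi> (x + t *\<^sub>R v) *v v)) (at t)"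
proof -
  have "((\<lambda>t. x + t *\<^sub>R v) has_derivative (\<lambda>s. s *\<^sub>R v)) (at t)"
    by (auto intro!: derivative_eq_intros)
  from has_derivative_compose[OF this hess_derivative]
  have "((\<lambda>t. u \<bullet> grad \<Phi> (x + t *\<^sub>R v)) has_derivative
      (\<lambda>s. u \<bullet> (hess \<Phi> (x + t *\<^sub>R v) *v (s *\<^sub>R v)))) (at t)"
    by (rule has_derivative_inner_right)
  then show ?thesis
    by (simp add: has_field_derivative_def matrix_vector_mult_scaleR mult.commute[of _ "u \<bullet> _"])
qed

lemma value_along_line:
  "((\<lambda>t. \<Phi> (x + t *\<^sub>R v)) has_real_derivative v \<bullet> grad \<Phi> (x + t *\<^sub>R v)) (at t)"
proof -
  have "((\<lambda>t. x + t *\<^sub>R v) has_derivative (\<lambda>s. s *\<^sub>R v)) (at t)"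
    by (auto intro!: derivative_eq_intros)
  from has_derivative_compose[OF this grad_derivative[unfolded gderiv_def]]
  show ?thesis
    by (simp add: has_field_derivative_def mult.commute[of _ "v \<bullet> _"])
qed

text \<open>Along the segment from \<open>x\<close> to \<open>y\<close> the component of the gradient in direction \<open>y - x\<close> has as its
  derivative a value of the Hessian form, which is at least \<open>\<mu> * (norm (y - x))\<^sup>2\<close>.\<close>
lemma grad_strongly_monotone:
  "\<mu> * (norm (y - x))\<^sup>2 \<le> (y - x) \<bullet> (grad \<Phi> y - grad \<Phi> x)"
proof -
  define v where "v = y - x"
  define \<psi> where "\<psi> t = v \<bullet> grad \<Phi> (x + t *\<^sub>R v) - \<mu> * (norm v)\<^sup>2 * t" for t
  have "\<psi> 0 \<le> \<psi> 1"
  proof (rule DERIV_nonneg_imp_nondecreasing, simp)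
    fix t :: real
    have "(\<psi> has_real_derivative
        (v \<bullet> (hess \<Phi> (x + t *\<^sub>R v) *v v) - \<mu> * (norm v)\<^sup>2)) (at t)"
      unfolding \<psi>_def by (rule derivative_eq_intros grad_along_line refl | simp)+
    moreover have "0 \<le> v \<bullet> (hess \<Phi> (x + t *\<^sub>R v) *v v) - \<mu> * (norm v)\<^sup>2"
      using hess_ge[of v] by simp
    ultimately show "\<exists>d. (\<psi> has_real_derivative d) (at t) \<and> 0 \<le> d" by blast
  qed
  then show ?thesis by (simp add: \<psi>_def v_def inner_diff_right)
qed

text \<open>Along the segment, the difference of both sides has derivative
  \<open>(y - x) \<bullet> (grad \<Phi> (x + t *\<^sub>R (y - x)) - grad \<Phi> x) - \<mu> * (norm (y - x))\<^sup>2 * t\<close>, which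
  is nonnegative by strong monotonicity of the gradient.\<close>
lemma quadratic_lower_bound:
  "\<Phi> x + grad \<Phi> x \<bullet> (y - x) + \<mu> / 2 * (norm (y - x))\<^sup>2 \<le> \<Phi> y"
proof -
  define v where "v = y - x"
  define \<psi> where "\<psi> t = \<Phi> (x + t *\<^sub>R v) - t * (v \<bullet> grad \<Phi> x) - \<mu> / 2 * (norm v)\<^sup>2 * t\<^sup>2" for t
  have "\<psi> 0 \<le> \<psi> 1"
  proof (rule DERIV_nonneg_imp_nondecreasing, simp)
    fix t :: real assume t: "0 \<le> t" "t \<le> 1"
    have "(\<psi> has_real_derivative
        (v \<bullet> grad \<Phi> (x + t *\<^sub>R v) - v \<bullet> grad \<Phi> x - \<mu> * (norm v)\<^sup>2 * t)) (at t)"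
      unfolding \<psi>_def
      by (rule derivative_eq_intros value_along_line refl | simp)+
    moreover have "0 \<le> v \<bullet> grad \<Phi> (x + t *\<^sub>R v) - v \<bullet> grad \<Phi> x - \<mu> * (norm v)\<^sup>2 * t"
    proof (cases "t = 0")
      case False
      have "t * (\<mu> * (norm v)\<^sup>2 * t) \<le> t * (v \<bullet> grad \<Phi> (x + t *\<^sub>R v) - v \<bullet> grad \<Phi> x)"
        using grad_strongly_monotone[of "x + t *\<^sub>R v" x]
        by (simp add: power_mult_distrib inner_diff_right algebra_simps power2_eq_square)
      with False t show ?thesis by simp
    qed simp
    ultimately show "\<exists>d. (\<psi> has_real_derivative d) (at t) \<and> 0 \<le> d" by blast
  qed
  then show ?thesis by (simp add: \<psi>_def v_def inner_commute)
qed

lemma stationary_unique_minimizer: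
  assumes "grad \<Phi> xs = 0"
  shows "unique_minimizer \<Phi> xs"
proof -
  have growth: "\<Phi> xs + \<mu> / 2 * (norm (y - xs))\<^sup>2 \<le> \<Phi> y" for y
    using quadratic_lower_bound[of xs y] assms by simp
  have min: "\<Phi> xs \<le> \<Phi> y" for y
    using growth[of y] mu_pos by (smt (verit) divide_pos_pos mult_nonneg_nonneg zero_le_power2)
  have "y = xs" if "\<Phi> y \<le> \<Phi> xs" for y
  proof (rule ccontr)
    assume "y \<noteq> xs"
    then have "0 < \<mu> / 2 * (norm (y - xs))\<^sup>2" using mu_pos by simp
    with growth[of y] that show False by linarith
  qed
  with min show ?thesis
    by (auto simp: unique_minimizer_def is_arg_min_linorder)
qed

text \<open>By the quadratic lower bound, \<open>\<Phi>\<close> is at least \<open>\<Phi> 0\<close> outside a ball around \<open>0\<close>, so its minimum over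
  that compact ball is a global one.\<close>
lemma ex_stationary: "\<exists>xs. grad \<Phi> xs = 0"
proof -
  (* Beyond this radius the quadratic term outweighs the linear one. *)
  define R where "R = 2 * norm (grad \<Phi> 0) / \<mu>"
  have cont: "continuous_on A \<Phi>" for A
    using grad_derivative unfolding gderiv_def
    by (meson continuous_at_imp_continuous_on has_derivative_continuous)
  have "0 \<le> R" using mu_pos by (simp add: R_def)
  then obtain xs where xs: "xs \<in> cball 0 R" and inball: "\<And>y. y \<in> cball 0 R \<Longrightarrow> \<Phi> xs \<le> \<Phi> y"
    using continuous_attains_inf[OF compact_cball _ cont, of 0 R] by auto
  have "\<Phi> xs \<le> \<Phi> y" for y
  proof (cases "y \<in> cball 0 R")
    case False
    then have "R \<le> norm y" by simp
    then have "norm (grad \<Phi> 0) \<le> \<mu> / 2 * norm y"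
      using mu_pos by (simp add: R_def field_simps)
    then have "norm (grad \<Phi> 0) * norm y \<le> \<mu> / 2 * norm y * norm y"
      by (rule mult_right_mono) simp
    moreover have "- (norm (grad \<Phi> 0) * norm y) \<le> grad \<Phi> 0 \<bullet> y"
      using Cauchy_Schwarz_ineq2[of "grad \<Phi> 0" y] by linarith
    ultimately have "\<Phi> 0 \<le> \<Phi> y"
      using quadratic_lower_bound[of 0 y] by (simp add: power2_eq_square)
    moreover have "\<Phi> xs \<le> \<Phi> 0" using inball[of 0] \<open>0 \<le> R\<close> by simp
    ultimately show ?thesis by simp
  qed (use inball in auto)
  then have "(\<lambda>h. h \<bullet> grad \<Phi> xs) = (\<lambda>h. 0)"
    using grad_derivative[of xs, unfolded gderiv_def]
    by (intro has_derivative_local_min[of \<Phi>]) auto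
  then have "grad \<Phi> xs \<bullet> grad \<Phi> xs = 0" by meson
  then show ?thesis by auto
qed

lemma infnorm_le_hess: "infnorm v \<le> \<kappa> * infnorm (hess \<Phi> x *v v)"
  unfolding \<kappa>_def by (rule infnorm_le_of_strong_monotonicity[OF mu_pos hess_ge])

lemma infnorm_diff_le_grad: "infnorm (x - y) \<le> \<kappa> * infnorm (grad \<Phi> x - grad \<Phi> y)"
  unfolding \<kappa>_def by (rule infnorm_le_of_strong_monotonicity[OF mu_pos grad_strongly_monotone])

text \<open>The Taylor estimate is proved for each coordinate: \<open>t \<mapsto> (grad \<Phi> (x + t *\<^sub>R v) - t *\<^sub>R (hess \<Phi> x *v v)) $ p\<close>
  has a derivative of absolute value at most \<open>L * (infnorm v)\<^sup>2 * t\<close>. This yields the constant \<open>L / 2\<close> directly for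
  the max norm, without passing through the Euclidean one.\<close>
lemma grad_linearization:
  "infnorm (grad \<Phi> (x + v) - grad \<Phi> x - hess \<Phi> x *v v) \<le> L / 2 * (infnorm v)\<^sup>2"
proof (rule infnorm_le_cartI)
  fix p
  define G where "G t = axis p 1 \<bullet> grad \<Phi> (x + t *\<^sub>R v)" for t :: real
  define D where "D t = axis p 1 \<bullet> (hess \<Phi> (x + t *\<^sub>R v) *v v)" for t :: real
  have DG: "(G has_real_derivative D t) (at t)" for t
    unfolding G_def D_def by (rule grad_along_line)
  have D: "\<bar>D t - D 0\<bar> \<le> L * (infnorm v)\<^sup>2 * t" if "0 \<le> t" for t
  proof -
    have "\<bar>D t - D 0\<bar> \<le> infnorm (hess \<Phi> (x + t *\<^sub>R v) *v v - hess \<Phi> x *v v)"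
      using component_le_infnorm_cart[of "hess \<Phi> (x + t *\<^sub>R v) *v v - hess \<Phi> x *v v" p]
      by (simp add: D_def inner_axis')
    also have "\<dots> \<le> L * (infnorm v)\<^sup>2 * t"
      using hess_lipschitz[of "x + t *\<^sub>R v" v x] that
      by (simp add: infnorm_mul power2_eq_square mult_ac)
    finally show ?thesis .
  qed
  (* Both signs s = 1 and s = -1 are needed to bound an absolute value. *)
  define \<psi> where "\<psi> s t = L / 2 * (infnorm v)\<^sup>2 * t\<^sup>2 + s * (G t - t * D 0)" for s t
  have "\<psi> s 0 \<le> \<psi> s 1" if s: "s = 1 \<or> s = -1" for s
  proof (rule DERIV_nonneg_imp_nondecreasing, simp)
    fix t :: real assume "0 \<le> t"
    have "(\<psi> s has_real_derivative (L * (infnorm v)\<^sup>2 * t + s * (D t - D 0))) (at t)"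
      unfolding \<psi>_def by (rule derivative_eq_intros DG refl | simp)+
    moreover have "0 \<le> L * (infnorm v)\<^sup>2 * t + s * (D t - D 0)"
      using D[OF \<open>0 \<le> t\<close>] s by auto
    ultimately show "\<exists>d. (\<psi> s has_real_derivative d) (at t) \<and> 0 \<le> d" by blast
  qed
  from this[of 1] this[of "-1"]
  have "\<bar>G 1 - G 0 - D 0\<bar> \<le> L / 2 * (infnorm v)\<^sup>2"
    unfolding abs_le_iff by (simp add: \<psi>_def)
  then show "\<bar>(grad \<Phi> (x + v) - grad \<Phi> x - hess \<Phi> x *v v) $ p\<bar> \<le> L / 2 * (infnorm v)\<^sup>2"
    by (simp add: G_def D_def inner_axis')
qed

section \<open>Acceptance of damped inexact Newton steps\<close>

text \<open>With the residual \<open>\<rho> = hess \<Phi> x *v d - grad \<Phi> x\<close> of the linear system, the new gradient is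
  \<open>(1 - a) *\<^sub>R grad \<Phi> x - a *\<^sub>R \<rho>\<close> plus the Taylor remainder, and
  \<open>infnorm d \<le> \<kappa> * (1 + e) * infnorm (grad \<Phi> x)\<close> controls the remainder.\<close>
lemma damped_step_grad_bound:
  assumes res: "infnorm (hess \<Phi> x *v d - grad \<Phi> x) \<le> e * infnorm (grad \<Phi> x)"
    and a: "0 \<le> a" "a \<le> 1"
  shows "infnorm (grad \<Phi> (x - a *\<^sub>R d)) \<le> (1 - a * (1 - e)) * infnorm (grad \<Phi> x)
      + L * \<kappa>\<^sup>2 / 2 * (a\<^sup>2 * (1 + e)\<^sup>2 * (infnorm (grad \<Phi> x))\<^sup>2)"
proof -
  define G where "G = infnorm (grad \<Phi> x)"
  define v where "v = - (a *\<^sub>R d)"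
  define R where "R = grad \<Phi> (x + v) - grad \<Phi> x - hess \<Phi> x *v v"
  define \<rho> where "\<rho> = hess \<Phi> x *v d - grad \<Phi> x"
  have rho: "infnorm \<rho> \<le> e * G" using res by (simp add: \<rho>_def G_def)
  have "infnorm d \<le> \<kappa> * infnorm (\<rho> + grad \<Phi> x)"
    using infnorm_le_hess[of d x] by (simp add: \<rho>_def)
  also have "\<dots> \<le> \<kappa> * ((1 + e) * G)"
    using infnorm_triangle[of \<rho> "grad \<Phi> x"] rho kappa_pos
    by (intro mult_left_mono) (auto simp: G_def algebra_simps)
  finally have "a * infnorm d \<le> a * (\<kappa> * ((1 + e) * G))"
    by (rule mult_left_mono[OF _ a(1)])
  then have "(infnorm v)\<^sup>2 \<le> (a * (\<kappa> * ((1 + e) * G)))\<^sup>2"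
    using a by (intro power_mono) (auto simp: v_def infnorm_neg infnorm_mul infnorm_pos_le)
  then have "L / 2 * (infnorm v)\<^sup>2 \<le> L / 2 * (a * (\<kappa> * ((1 + e) * G)))\<^sup>2"
    using L_pos by (intro mult_left_mono) auto
  then have R: "infnorm R \<le> L * \<kappa>\<^sup>2 / 2 * (a\<^sup>2 * (1 + e)\<^sup>2 * G\<^sup>2)"
    using grad_linearization[of x v] by (simp add: R_def power_mult_distrib mult_ac)
  have "grad \<Phi> (x - a *\<^sub>R d) = ((1 - a) *\<^sub>R grad \<Phi> x + (- a) *\<^sub>R \<rho>) + R"
    by (simp add: R_def \<rho>_def v_def algebra_simps matrix_vector_mult_scaleR
        linear_neg[OF matrix_vector_mul_linear])
  then have "infnorm (grad \<Phi> (x - a *\<^sub>R d)) \<le> (1 - a) * G + a * infnorm \<rho> + infnorm R"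
    using infnorm_triangle[of "(1 - a) *\<^sub>R grad \<Phi> x + (- a) *\<^sub>R \<rho>" R]
      infnorm_triangle[of "(1 - a) *\<^sub>R grad \<Phi> x" "(- a) *\<^sub>R \<rho>"] a
    by (simp only: infnorm_mul G_def) simp
  also have "a * infnorm \<rho> \<le> a * (e * G)" using rho a by (intro mult_left_mono) auto
  finally show ?thesis using R by (simp add: G_def algebra_simps)
qed

text \<open>If \<open>a < 1\<close>, the step length satisfies \<open>a * G = (1 - e) / (1 + e)\<^sup>2 * \<gamma>\<close>. The gain
  \<open>a * (1 - e) * G\<close> is then \<open>(1 - e)\<^sup>2 / (1 + e)\<^sup>2 * \<gamma>\<close>, and for \<open>\<gamma> \<le> 1 / (L * \<kappa>\<^sup>2)\<close> the
  quadratic term takes away at most half of it. If \<open>a = 1\<close>, the damped step bound is the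
  acceptance test itself.\<close>
lemma accepted_if_small:
  assumes e: "0 \<le> e" "e < 1" and gam: "0 < \<gamma>" "\<gamma> * (L * \<kappa>\<^sup>2) \<le> 1"
    and res: "infnorm (hess \<Phi> x *v d - grad \<Phi> x) \<le> e * infnorm (grad \<Phi> x)"
  shows "accepted \<Phi> e \<gamma> x d"
proof -
  define G where "G = infnorm (grad \<Phi> x)"
  define a where "a = step_length \<Phi> e \<gamma> x"
  define G' where "G' = infnorm (grad \<Phi> (trial_point \<Phi> e \<gamma> x d))"
  have G0: "0 \<le> G" by (simp add: G_def infnorm_pos_le)
  have a: "0 \<le> a" "a \<le> 1"
    using e gam G0 by (auto simp: a_def step_length_def G_def)
  have G': "G' \<le> (1 - a * (1 - e)) * G + L * \<kappa>\<^sup>2 / 2 * (a\<^sup>2 * (1 + e)\<^sup>2 * G\<^sup>2)"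
    using damped_step_grad_bound[OF res a] by (simp add: G'_def G_def a_def trial_point_def)
  have LK: "L * \<kappa>\<^sup>2 / 2 \<le> 1 / (2 * \<gamma>)"
    using gam by (simp add: field_simps)
  have quad: "L * \<kappa>\<^sup>2 / 2 * (a\<^sup>2 * (1 + e)\<^sup>2 * G\<^sup>2) \<le> 1 / (2 * \<gamma>) * (a\<^sup>2 * (1 + e)\<^sup>2 * G\<^sup>2)"
    by (rule mult_right_mono[OF LK]) simp
  show ?thesis
  proof (cases "a = 1")
    case True
    then have "G' \<le> e * G + 1 / (2 * \<gamma>) * (1 + e)\<^sup>2 * G\<^sup>2"
      using G' quad by simp
    with True show ?thesis by (simp add: accepted_def a_def G'_def G_def)
  next
    case False
    with a have a1: "a < 1" by simp
    then have "grad \<Phi> x \<noteq> 0" by (auto simp: a_def step_length_def)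
    then have Gp: "0 < G" by (simp add: G_def infnorm_pos_lt)
    have aG: "a * G = (1 - e) / (1 + e)\<^sup>2 * \<gamma>"
      using a1 Gp \<open>grad \<Phi> x \<noteq> 0\<close> by (auto simp: a_def step_length_def G_def min_def split: if_splits)
    have lin: "a * (1 - e) * G = (1 - e)\<^sup>2 / (1 + e)\<^sup>2 * \<gamma>"
      using arg_cong[OF aG, of "\<lambda>s. (1 - e) * s"] by (simp add: power2_eq_square mult_ac)
    have "a\<^sup>2 * (1 + e)\<^sup>2 * G\<^sup>2 = (a * G * (1 + e))\<^sup>2"
      by (simp add: power_mult_distrib)
    also have "a * G * (1 + e) = (1 - e) / (1 + e) * \<gamma>"
      using e unfolding aG by (simp add: power2_eq_square)
    finally have "1 / (2 * \<gamma>) * (a\<^sup>2 * (1 + e)\<^sup>2 * G\<^sup>2) = 1 / 2 * ((1 - e)\<^sup>2 / (1 + e)\<^sup>2) * \<gamma>"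
      using gam by (simp add: power2_eq_square)
    moreover have "(1 - a * (1 - e)) * G = G - a * (1 - e) * G" by algebra
    ultimately have "G' \<le> G - 1 / 2 * ((1 - e)\<^sup>2 / (1 + e)\<^sup>2) * \<gamma>"
      using G' quad lin by linarith
    with a1 show ?thesis by (simp add: accepted_def a_def G'_def G_def)
  qed
qed

text \<open>A step with \<open>a < 1\<close> drops by the amount of its test, bounded below by means of \<open>1 + e \<le> 2\<close>. A full
  step requires \<open>(1 + e)\<^sup>2 * G \<le> (1 - e) * \<gamma>\<close>, so the quadratic term of its test is at most
  \<open>(1 - e) / 2 * G\<close> and the test gives the contraction factor \<open>(1 + e) / 2\<close>.\<close>
lemma accepted_drop_or_contract:
  assumes e: "0 \<le> e" "e \<le> \<epsilon>" "\<epsilon> < 1" and gam: "0 < \<gamma>\<^sub>m" "\<gamma>\<^sub>m \<le> \<gamma>"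
    and acc: "accepted \<Phi> e \<gamma> x d"
  defines "G \<equiv> infnorm (grad \<Phi> x)"
    and "G' \<equiv> infnorm (grad \<Phi> (trial_point \<Phi> e \<gamma> x d))"
  shows "G' \<le> G - (1 - \<epsilon>)\<^sup>2 * \<gamma>\<^sub>m / 8 \<or>
    (G' \<le> (1 + \<epsilon>) / 2 * G \<and> G' \<le> e * G + 2 / \<gamma>\<^sub>m * G\<^sup>2)"
proof (cases "step_length \<Phi> e \<gamma> x = 1")
  case False
  then have G': "G' \<le> G - 1 / 2 * ((1 - e)\<^sup>2 / (1 + e)\<^sup>2) * \<gamma>"
    using acc by (simp add: accepted_def G_def G'_def)
  have "(1 - \<epsilon>)\<^sup>2 \<le> (1 - e)\<^sup>2" using e by (intro power_mono) auto
  moreover have "(1 + e)\<^sup>2 \<le> 2\<^sup>2" using e by (intro power_mono) auto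
  ultimately have "(1 - \<epsilon>)\<^sup>2 / 4 \<le> (1 - e)\<^sup>2 / (1 + e)\<^sup>2"
    using e by (intro frac_le) auto
  then have "(1 - \<epsilon>)\<^sup>2 / 4 * \<gamma>\<^sub>m \<le> (1 - e)\<^sup>2 / (1 + e)\<^sup>2 * \<gamma>"
    using gam by (intro mult_mono) auto
  with G' show ?thesis by simp
next
  case True
  have G0: "0 \<le> G" by (simp add: G_def infnorm_pos_le)
  have gp: "0 < \<gamma>" using gam by simp
  have G': "G' \<le> e * G + 1 / (2 * \<gamma>) * (1 + e)\<^sup>2 * G\<^sup>2"
    using acc True by (simp add: accepted_def G_def G'_def)
  have full: "(1 + e)\<^sup>2 * G \<le> (1 - e) * \<gamma>"
  proof (cases "grad \<Phi> x = 0")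
    case True
    then show ?thesis using e gp by (simp add: G_def infnorm_0)
  next
    case False
    then have "0 < G" by (simp add: G_def infnorm_pos_lt)
    moreover have "1 \<le> (1 - e) / (1 + e)\<^sup>2 * \<gamma> * (1 / G)"
      using True False by (simp add: step_length_def G_def min_def split: if_splits)
    ultimately show ?thesis using e by (simp add: field_simps)
  qed
  have "1 / (2 * \<gamma>) * (1 + e)\<^sup>2 * G\<^sup>2 = G / (2 * \<gamma>) * ((1 + e)\<^sup>2 * G)"
    by (simp add: power2_eq_square)
  also have "\<dots> \<le> G / (2 * \<gamma>) * ((1 - e) * \<gamma>)"
    using full G0 gp by (intro mult_left_mono) auto
  also have "\<dots> = (1 - e) / 2 * G" using gp by simp
  finally have "G' \<le> (1 + e) / 2 * G" using G' by (simp add: field_simps)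
  also have "\<dots> \<le> (1 + \<epsilon>) / 2 * G" using e G0 by (intro mult_right_mono) auto
  finally have 1: "G' \<le> (1 + \<epsilon>) / 2 * G" .
  have "(1 + e)\<^sup>2 \<le> 2\<^sup>2" using e by (intro power_mono) auto
  then have "1 / (2 * \<gamma>) * (1 + e)\<^sup>2 \<le> 1 / (2 * \<gamma>\<^sub>m) * 4"
    using gam by (intro mult_mono) (auto simp: field_simps)
  then have "1 / (2 * \<gamma>) * (1 + e)\<^sup>2 * G\<^sup>2 \<le> 2 / \<gamma>\<^sub>m * G\<^sup>2"
    by (intro mult_right_mono) auto
  with G' 1 show ?thesis by simp
qed

section \<open>Convergence and its rate\<close>

text \<open>Since the step parameters stay above a positive bound, one drop and one contraction factor serve
  all iterations. The drops end, and what remains is the acceptance test of full steps.\<close>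
lemma dinas_gradients:
  assumes din: "dinas \<Phi> \<gamma>\<^sub>0 q \<eta> x"
  shows "(\<lambda>k. infnorm (grad \<Phi> (x k))) \<longlonglongrightarrow> 0"
    and "\<exists>b>0. \<forall>\<^sub>F k in sequentially. infnorm (grad \<Phi> (x (Suc k)))
      \<le> \<eta> k * infnorm (grad \<Phi> (x k)) + b * (infnorm (grad \<Phi> (x k)))\<^sup>2"
proof -
  from din obtain \<epsilon> d \<gamma> where g0: "0 < \<gamma>\<^sub>0" and q: "0 < q" "q < 1"
    and eps: "\<epsilon> < 1" "\<And>k. 0 \<le> \<eta> k" "\<And>k. \<eta> k \<le> \<epsilon>"
    and gam0: "\<gamma> 0 = \<gamma>\<^sub>0"
    and res: "\<And>k. infnorm (hess \<Phi> (x k) *v d k - grad \<Phi> (x k)) \<le> \<eta> k * infnorm (grad \<Phi> (x k))"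
    and iter: "\<And>k. \<exists>j. accepted \<Phi> (\<eta> k) (q ^ j * \<gamma> k) (x k) (d k) \<and>
                  (\<forall>i<j. \<not> accepted \<Phi> (\<eta> k) (q ^ i * \<gamma> k) (x k) (d k)) \<and>
                  \<gamma> (Suc k) = q ^ j * \<gamma> k \<and>
                  x (Suc k) = trial_point \<Phi> (\<eta> k) (q ^ j * \<gamma> k) (x k) (d k)"
    unfolding dinas_def by blast
  have "\<epsilon> \<ge> 0" using eps(2,3)[of 0] by linarith
  have LK: "0 < L * \<kappa>\<^sup>2" using L_pos kappa_pos by simp
  (* A parameter that is rejected exceeds 1 / (L * \<kappa>\<^sup>2); after one more multiplication by q it is
     still at least q / (L * \<kappa>\<^sup>2). *)
  define \<gamma>\<^sub>m where "\<gamma>\<^sub>m = min \<gamma>\<^sub>0 (q / (L * \<kappa>\<^sup>2))"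
  have gm: "0 < \<gamma>\<^sub>m" using g0 q LK by (simp add: \<gamma>\<^sub>m_def)
  have gam: "\<gamma>\<^sub>m \<le> \<gamma> k" for k
  proof (induction k)
    case 0
    then show ?case by (simp add: gam0 \<gamma>\<^sub>m_def)
  next
    case (Suc k)
    obtain j where j: "\<forall>i<j. \<not> accepted \<Phi> (\<eta> k) (q ^ i * \<gamma> k) (x k) (d k)"
      "\<gamma> (Suc k) = q ^ j * \<gamma> k" using iter by blast
    show ?case
    proof (cases j)
      case 0
      with Suc j show ?thesis by simp
    next
      case (Suc i)
      with j have "\<not> accepted \<Phi> (\<eta> k) (q ^ i * \<gamma> k) (x k) (d k)" by simp
      moreover have "0 < q ^ i * \<gamma> k" using q gm \<open>\<gamma>\<^sub>m \<le> \<gamma> k\<close> by simp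
      ultimately have "1 < (q ^ i * \<gamma> k) * (L * \<kappa>\<^sup>2)"
        using accepted_if_small[OF eps(2) _ _ _ res[of k]] eps(1) eps(3)[of k] by fastforce
      then have "q * 1 \<le> q * ((q ^ i * \<gamma> k) * (L * \<kappa>\<^sup>2))"
        using q by (intro mult_left_mono) auto
      then have "q \<le> \<gamma> (Suc k) * (L * \<kappa>\<^sup>2)"
        using Suc j by (simp add: mult_ac)
      then have "q / (L * \<kappa>\<^sup>2) \<le> \<gamma> (Suc k)"
        using LK by (simp add: pos_divide_le_eq)
      then show ?thesis by (simp add: \<gamma>\<^sub>m_def)
    qed
  qed
  define G where "G k = infnorm (grad \<Phi> (x k))" for k
  have step: "G (Suc k) \<le> G k - (1 - \<epsilon>)\<^sup>2 * \<gamma>\<^sub>m / 8 \<or>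
      (G (Suc k) \<le> (1 + \<epsilon>) / 2 * G k \<and> G (Suc k) \<le> \<eta> k * G k + 2 / \<gamma>\<^sub>m * (G k)\<^sup>2)" for k
  proof -
    obtain j where "accepted \<Phi> (\<eta> k) (\<gamma> (Suc k)) (x k) (d k)"
      "x (Suc k) = trial_point \<Phi> (\<eta> k) (\<gamma> (Suc k)) (x k) (d k)" using iter by metis
    then show ?thesis
      using accepted_drop_or_contract[OF eps(2) eps(3) eps(1) gm gam] by (simp add: G_def)
  qed
  have c: "0 < (1 - \<epsilon>)\<^sup>2 * \<gamma>\<^sub>m / 8" using eps gm by simp
  have r: "0 \<le> (1 + \<epsilon>) / 2" "(1 + \<epsilon>) / 2 < 1" using eps \<open>\<epsilon> \<ge> 0\<close> by auto
  have nonneg: "0 \<le> G k" for k by (simp add: G_def infnorm_pos_le)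
  note lim = real_seq_drop_or_contract[of G, OF nonneg c r step]
  from lim(1) show "(\<lambda>k. infnorm (grad \<Phi> (x k))) \<longlonglongrightarrow> 0" by (simp add: G_def[abs_def])
  from lim(2) gm show "\<exists>b>0. \<forall>\<^sub>F k in sequentially. infnorm (grad \<Phi> (x (Suc k)))
      \<le> \<eta> k * infnorm (grad \<Phi> (x k)) + b * (infnorm (grad \<Phi> (x k)))\<^sup>2"
    by (intro exI[of _ "2 / \<gamma>\<^sub>m"]) (simp add: G_def)
qed

text \<open>The gradient is locally Lipschitz at its zero, by its linearization there. The radius \<open>1\<close> is an
  arbitrary choice.\<close>
lemma grad_le_near_stationary:
  assumes "grad \<Phi> xs = 0"
  shows "\<exists>C>0. \<forall>x. infnorm (x - xs) \<le> 1 \<longrightarrow> infnorm (grad \<Phi> x) \<le> C * infnorm (x - xs)"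
proof -
  define B where "B = \<bar>op_infnorm (hess \<Phi> xs)\<bar>"
  have B: "infnorm (hess \<Phi> xs *v v) \<le> B * infnorm v" for v
    using infnorm_mult_vec_le_op_infnorm[of "hess \<Phi> xs" v]
    by (rule order_trans) (simp add: B_def mult_right_mono infnorm_pos_le)
  have "infnorm (grad \<Phi> x) \<le> (B + L / 2) * infnorm (x - xs)" if x: "infnorm (x - xs) \<le> 1" for x
  proof -
    define v where "v = x - xs"
    have "infnorm (grad \<Phi> x) \<le> infnorm (grad \<Phi> (xs + v) - grad \<Phi> xs - hess \<Phi> xs *v v)
        + infnorm (hess \<Phi> xs *v v)"
      using infnorm_triangle[of "grad \<Phi> x - hess \<Phi> xs *v v" "hess \<Phi> xs *v v"] assms
      by (simp add: v_def)
    also have "\<dots> \<le> L / 2 * (infnorm v)\<^sup>2 + B * infnorm v"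
      by (intro add_mono grad_linearization B)
    also have "(infnorm v)\<^sup>2 \<le> infnorm v"
      using x by (simp add: v_def power2_eq_square mult_left_le infnorm_pos_le)
    finally show ?thesis using L_pos by (simp add: v_def algebra_simps)
  qed
  moreover have "0 < B + L / 2" using L_pos by (simp add: B_def add_nonneg_pos)
  ultimately show ?thesis by blast
qed

text \<open>The error is at most \<open>\<kappa>\<close> times the gradient, and the gradient is at most \<open>C\<close> times the error near the
  minimizer, so the gradient recursion turns into one for the errors. The order of the quantifiers
  matters: \<open>C\<close> is chosen before the run of the algorithm, which makes a threshold for the forcing
  terms possible, while \<open>b\<close> depends on the run through the smallest step parameter.\<close>
lemma dinas_errors:
  assumes xs: "grad \<Phi> xs = 0"
  shows "\<exists>C>0. (\<forall>x. infnorm (x - xs) \<le> 1 \<longrightarrow> infnorm (grad \<Phi> x) \<le> C * infnorm (x - xs)) \<and>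
    (\<forall>\<gamma>\<^sub>0 q \<eta> x. dinas \<Phi> \<gamma>\<^sub>0 q \<eta> x \<longrightarrow> (\<lambda>k. infnorm (x k - xs)) \<longlonglongrightarrow> 0 \<and>
      (\<exists>b>0. \<forall>\<^sub>F k in sequentially.
        infnorm (x (Suc k) - xs) \<le> (\<kappa> * C * \<eta> k + b * infnorm (x k - xs)) * infnorm (x k - xs)))"
proof -
  obtain C where C: "0 < C"
    "\<And>x. infnorm (x - xs) \<le> 1 \<Longrightarrow> infnorm (grad \<Phi> x) \<le> C * infnorm (x - xs)"
    using grad_le_near_stationary[OF xs] by blast
  have err: "infnorm (x - xs) \<le> \<kappa> * infnorm (grad \<Phi> x)" for x
    using infnorm_diff_le_grad[of x xs] xs by simp
  have lim: "(\<lambda>k. infnorm (x k - xs)) \<longlonglongrightarrow> 0" if "dinas \<Phi> \<gamma>\<^sub>0 q \<eta> x" for \<gamma>\<^sub>0 q \<eta> x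
  proof (rule tendsto_sandwich[OF _ _ tendsto_const])
    show "(\<lambda>k. \<kappa> * infnorm (grad \<Phi> (x k))) \<longlonglongrightarrow> 0"
      using tendsto_mult_right_zero[OF dinas_gradients(1)[OF that], of \<kappa>] by simp
  qed (auto simp: infnorm_pos_le err)
  have "\<exists>b>0. \<forall>\<^sub>F k in sequentially. infnorm (x (Suc k) - xs)
      \<le> (\<kappa> * C * \<eta> k + b * infnorm (x k - xs)) * infnorm (x k - xs)"
    if din: "dinas \<Phi> \<gamma>\<^sub>0 q \<eta> x" for \<gamma>\<^sub>0 q \<eta> x
  proof -
    obtain b where b: "0 < b" "\<forall>\<^sub>F k in sequentially. infnorm (grad \<Phi> (x (Suc k)))
      \<le> \<eta> k * infnorm (grad \<Phi> (x k)) + b * (infnorm (grad \<Phi> (x k)))\<^sup>2"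
      using dinas_gradients(2)[OF din] by blast
    have eta: "0 \<le> \<eta> k" for k using din by (auto simp: dinas_def)
    have "\<forall>\<^sub>F k in sequentially. infnorm (x k - xs) < 1"
      using lim[OF din] by (rule order_tendstoD) simp
    with b(2) have "\<forall>\<^sub>F k in sequentially. infnorm (x (Suc k) - xs)
      \<le> (\<kappa> * C * \<eta> k + (\<kappa> * b * C\<^sup>2) * infnorm (x k - xs)) * infnorm (x k - xs)"
    proof eventually_elim
      case (elim k)
      define G where "G = infnorm (grad \<Phi> (x k))"
      define t where "t = infnorm (x k - xs)"
      have G: "0 \<le> G" "G \<le> C * t"
        using C(2)[of "x k"] elim(2) by (auto simp: G_def t_def infnorm_pos_le)
      have "infnorm (x (Suc k) - xs) \<le> \<kappa> * (\<eta> k * G + b * G\<^sup>2)"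
        using err[of "x (Suc k)"] elim(1) kappa_pos
        by (smt (verit) G_def mult_left_mono)
      also have "\<dots> \<le> \<kappa> * (\<eta> k * (C * t) + b * (C * t)\<^sup>2)"
        using G b(1) eta[of k] kappa_pos
        by (intro mult_left_mono add_mono power_mono) auto
      finally show ?case by (simp add: t_def power2_eq_square algebra_simps)
    qed
    moreover have "0 < \<kappa> * b * C\<^sup>2" using kappa_pos b C by simp
    ultimately show ?thesis by blast
  qed
  with C lim show ?thesis by blast
qed

lemma dinas_linear:
  assumes xs: "grad \<Phi> xs = 0"
  shows "\<exists>\<theta>>0. \<forall>\<gamma>\<^sub>0 q \<eta> x. dinas \<Phi> \<gamma>\<^sub>0 q \<eta> x \<longrightarrow> (\<forall>k. \<eta> k \<le> \<theta>) \<longrightarrow> converges_linearly x xs"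
proof -
  from dinas_errors[OF xs] obtain C where C: "0 < C"
    and lim: "\<And>\<gamma>\<^sub>0 q \<eta> x. dinas \<Phi> \<gamma>\<^sub>0 q \<eta> x \<Longrightarrow> (\<lambda>k. infnorm (x k - xs)) \<longlonglongrightarrow> 0"
    and rec: "\<And>\<gamma>\<^sub>0 q \<eta> x. dinas \<Phi> \<gamma>\<^sub>0 q \<eta> x \<Longrightarrow> \<exists>b>0. \<forall>\<^sub>F k in sequentially.
      infnorm (x (Suc k) - xs) \<le> (\<kappa> * C * \<eta> k + b * infnorm (x k - xs)) * infnorm (x k - xs)"
    by blast
  (* This bounds \<kappa> * C * \<eta> k by 1/4; small errors contribute another 1/4 to the ratio. *)
  define \<theta> where "\<theta> = 1 / (4 * \<kappa> * C)"
  have "converges_linearly x xs" if din: "dinas \<Phi> \<gamma>\<^sub>0 q \<eta> x" and small: "\<forall>k. \<eta> k \<le> \<theta>" for \<gamma>\<^sub>0 q \<eta> x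
  proof -
    obtain b where b: "0 < b" "\<forall>\<^sub>F k in sequentially.
      infnorm (x (Suc k) - xs) \<le> (\<kappa> * C * \<eta> k + b * infnorm (x k - xs)) * infnorm (x k - xs)"
      using rec[OF din] by blast
    have "\<forall>\<^sub>F k in sequentially. infnorm (x k - xs) < 1 / (4 * b)"
      using lim[OF din] b by (intro order_tendstoD) auto
    with b(2) have "\<forall>\<^sub>F k in sequentially. infnorm (x (Suc k) - xs) \<le> 1 / 2 * infnorm (x k - xs)"
    proof eventually_elim
      case (elim k)
      have "\<kappa> * C * \<eta> k \<le> \<kappa> * C * \<theta>"
        using small kappa_pos C by (intro mult_left_mono) auto
      also have "\<dots> = 1 / 4" using kappa_pos C by (simp add: \<theta>_def)
      finally have "\<kappa> * C * \<eta> k + b * infnorm (x k - xs) \<le> 1 / 2"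
        using elim(2) b(1) by (simp add: field_simps)
      then show ?case
        using elim(1) infnorm_pos_le[of "x k - xs"] by (meson mult_right_mono order_trans)
    qed
    with lim[OF din] show ?thesis
      unfolding converges_linearly_def by (intro conjI exI[of _ "1 / 2"]) auto
  qed
  moreover have "0 < \<theta>" using kappa_pos C by (simp add: \<theta>_def)
  ultimately show ?thesis by blast
qed

lemma dinas_superlinear:
  assumes xs: "grad \<Phi> xs = 0" and din: "dinas \<Phi> \<gamma>\<^sub>0 q \<eta> x" and "0 < \<delta>"
    and forcing: "\<forall>\<^sub>F k in sequentially. \<eta> k \<le> c * infnorm (grad \<Phi> (x k)) powr \<delta>"
  shows "converges_superlinearly x xs"
proof -
  obtain C b where lim: "(\<lambda>k. infnorm (x k - xs)) \<longlonglongrightarrow> 0"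
    and rec: "\<forall>\<^sub>F k in sequentially.
      infnorm (x (Suc k) - xs) \<le> (\<kappa> * C * \<eta> k + b * infnorm (x k - xs)) * infnorm (x k - xs)"
    using dinas_errors[OF xs] din by blast
  have "(\<lambda>k. infnorm (grad \<Phi> (x k)) powr \<delta>) \<longlonglongrightarrow> 0"
    using dinas_gradients(1)[OF din] \<open>0 < \<delta>\<close>
    by (intro tendsto_zero_powrI[where b = \<delta>]) (auto simp: infnorm_pos_le)
  then have "(\<lambda>k. c * infnorm (grad \<Phi> (x k)) powr \<delta>) \<longlonglongrightarrow> 0"
    by (rule tendsto_mult_right_zero)
  then have "\<eta> \<longlonglongrightarrow> 0"
    by (rule tendsto_sandwich[OF _ forcing tendsto_const, rotated])
       (use din in \<open>auto simp: dinas_def\<close>)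
  then have "(\<lambda>k. \<kappa> * C * \<eta> k + b * infnorm (x k - xs)) \<longlonglongrightarrow> 0"
    using lim by (intro tendsto_add_zero tendsto_mult_right_zero)
  with lim rec show ?thesis unfolding converges_superlinearly_def by blast
qed

lemma dinas_quadratic:
  assumes xs: "grad \<Phi> xs = 0" and din: "dinas \<Phi> \<gamma>\<^sub>0 q \<eta> x" and "0 \<le> c"
    and forcing: "\<forall>\<^sub>F k in sequentially. \<eta> k \<le> c * infnorm (grad \<Phi> (x k))"
  shows "converges_quadratically x xs"
proof -
  obtain C b where C: "0 < C" and b: "0 < b"
    and grad: "\<And>x. infnorm (x - xs) \<le> 1 \<Longrightarrow> infnorm (grad \<Phi> x) \<le> C * infnorm (x - xs)"
    and lim: "(\<lambda>k. infnorm (x k - xs)) \<longlonglongrightarrow> 0"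
    and rec: "\<forall>\<^sub>F k in sequentially.
      infnorm (x (Suc k) - xs) \<le> (\<kappa> * C * \<eta> k + b * infnorm (x k - xs)) * infnorm (x k - xs)"
    using dinas_errors[OF xs] din by blast
  have "\<forall>\<^sub>F k in sequentially. infnorm (x k - xs) < 1"
    using lim by (rule order_tendstoD) simp
  with rec forcing have "\<forall>\<^sub>F k in sequentially.
      infnorm (x (Suc k) - xs) \<le> (\<kappa> * C * (c * C) + b) * (infnorm (x k - xs))\<^sup>2"
  proof eventually_elim
    case (elim k)
    have "\<eta> k \<le> c * (C * infnorm (x k - xs))"
      using elim(2) grad[of "x k"] elim(3) \<open>0 \<le> c\<close> by (smt (verit) mult_left_mono)
    then have "\<kappa> * C * \<eta> k \<le> \<kappa> * C * (c * (C * infnorm (x k - xs)))"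
      using kappa_pos C by (intro mult_left_mono) auto
    then have "(\<kappa> * C * \<eta> k + b * infnorm (x k - xs)) * infnorm (x k - xs)
      \<le> (\<kappa> * C * (c * (C * infnorm (x k - xs))) + b * infnorm (x k - xs)) * infnorm (x k - xs)"
      by (intro mult_right_mono add_right_mono infnorm_pos_le)
    with elim(1) show ?case by (simp add: power2_eq_square algebra_simps)
  qed
  moreover have "0 < \<kappa> * C * (c * C) + b"
    using kappa_pos C b \<open>0 \<le> c\<close> by (simp add: add_nonneg_pos)
  ultimately show ?thesis using lim unfolding converges_quadratically_def by blast
qed

end

section \<open>The penalty function\<close>

lemma linear_block: "linear (\<lambda>x. block x i)"
  by (rule linearI) (simp_all add: block_def vec_eq_iff)

lemma block_diff: "block (x - y) i = block x i - block y i"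
  by (simp add: block_def vec_eq_iff)

lemma infnorm_block_le: "infnorm (block x i) \<le> infnorm x"
  by (rule infnorm_le_cartI) (simp add: block_def component_le_infnorm_cart)

lemma inner_eq_sum_block: "x \<bullet> y = (\<Sum>i\<in>UNIV. block x i \<bullet> block y i)"
  by (simp add: inner_vec_def block_def sum.cartesian_product flip: UNIV_Times_UNIV)

lemma kron_mat_1_mult_vec: "(kron A (mat 1) *v x) $ (i, a) = (\<Sum>j\<in>UNIV. A $ i $ j * x $ (j, a))"
proof -
  have "(kron A (mat 1) *v x) $ (i, a) = (\<Sum>j\<in>UNIV. \<Sum>b\<in>UNIV. A $ i $ j * (mat 1 $ a $ b) * x $ (j, b))"
    by (simp add: matrix_vector_mult_def kron_def sum.cartesian_product split_def flip: UNIV_Times_UNIV)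
  also have "\<dots> = (\<Sum>j\<in>UNIV. \<Sum>b\<in>UNIV. if a = b then A $ i $ j * x $ (j, b) else 0)"
    by (intro sum.cong refl) (simp add: mat_def)
  finally show ?thesis by simp
qed

lemma block_kron: "block (kron A (mat 1) *v x) i = (\<Sum>j\<in>UNIV. A $ i $ j *\<^sub>R block x j)"
  by (simp add: vec_eq_iff block_def[of "kron A (mat 1) *v x"] kron_mat_1_mult_vec) (simp add: block_def)

text \<open>Bounding each \<open>block x i \<bullet> block x j\<close> by the mean of the two squared norms leaves, after summation
  over the other index, row sums and column sums of \<open>W\<close>, which are \<open>1\<close>.\<close>
lemma kron_form_le:
  fixes W :: "real^'N::finite^'N" and x :: "real^('N \<times> 'n::finite)"
  assumes "doubly_stochastic W"
  shows "x \<bullet> (kron W (mat 1) *v x) \<le> x \<bullet> x"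
proof -
  have W: "0 \<le> W $ i $ j" "(\<Sum>j\<in>UNIV. W $ i $ j) = 1" "(\<Sum>i\<in>UNIV. W $ i $ j) = 1" for i j
    using assms by (auto simp: doubly_stochastic_def)
  have amgm: "u \<bullet> v \<le> (u \<bullet> u + v \<bullet> v) / 2" for u v :: "real^'n"
    using inner_ge_zero[of "u - v"] by (simp add: inner_diff inner_commute)
  let ?b = "\<lambda>i. block x i \<bullet> block x i"
  have "x \<bullet> (kron W (mat 1) *v x) = (\<Sum>i\<in>UNIV. \<Sum>j\<in>UNIV. W $ i $ j * (block x i \<bullet> block x j))"
    by (simp add: inner_eq_sum_block block_kron inner_sum_right)
  also have "\<dots> \<le> (\<Sum>i\<in>UNIV. \<Sum>j\<in>UNIV. W $ i $ j * ((?b i + ?b j) / 2))"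
    by (intro sum_mono mult_left_mono amgm W)
  also have "\<dots> = (\<Sum>i\<in>UNIV. \<Sum>j\<in>UNIV. W $ i $ j * (?b i / 2)) + (\<Sum>i\<in>UNIV. \<Sum>j\<in>UNIV. W $ i $ j * (?b j / 2))"
    by (simp add: sum.distrib add_divide_distrib distrib_left)
  also have "(\<Sum>i\<in>UNIV. \<Sum>j\<in>UNIV. W $ i $ j * (?b j / 2)) = (\<Sum>j\<in>UNIV. \<Sum>i\<in>UNIV. W $ i $ j * (?b j / 2))"
    by (rule sum.swap)
  also have "(\<Sum>i\<in>UNIV. \<Sum>j\<in>UNIV. W $ i $ j * (?b i / 2)) + \<dots> = (\<Sum>i\<in>UNIV. ?b i)"
    by (simp add: W flip: sum_distrib_right sum_divide_distrib)
  finally show ?thesis by (simp add: inner_eq_sum_block)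
qed

text \<open>The weighted graph Laplacian \<open>I - W\<close>, acting on each of the coordinates of the blocks.\<close>
definition laplacian :: "real^'N::finite^'N \<Rightarrow> real^('N \<times> 'n::finite)^('N \<times> 'n)" where
  "laplacian W = mat 1 - kron W (mat 1)"

lemma laplacian_nonneg:
  assumes "doubly_stochastic W"
  shows "0 \<le> x \<bullet> (laplacian W *v x)"
  using kron_form_le[OF assms, of x]
  by (simp add: laplacian_def matrix_vector_mult_diff_rdistrib inner_diff_right)

lemma transpose_laplacian: "transpose W = W \<Longrightarrow> transpose (laplacian W) = laplacian W"
  by (simp add: laplacian_def kron_def transpose_def vec_eq_iff mat_def eq_commute)

text \<open>The symmetry of \<open>W\<close> is what makes \<open>2 *\<^sub>R (laplacian W *v x)\<close> the gradient of the quadratic form.\<close>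
lemma penalty_GDERIV:
  fixes f :: "'N::finite \<Rightarrow> real^'n::finite \<Rightarrow> real"
  assumes W: "transpose W = W" and f: "\<And>i y. f i differentiable (at y)"
  shows "GDERIV (penalty f W \<beta>) x :>
    ((\<chi> p. grad (f (fst p)) (block x (fst p)) $ snd p) + (1 / \<beta>) *\<^sub>R (laplacian W *v x))"
proof -
  define S :: "real^('N \<times> 'n)^('N \<times> 'n)" where "S = laplacian W"
  define g where "g = (\<chi> p. grad (f (fst p)) (block x (fst p)) $ snd p)"
  have bg: "block g i = grad (f i) (block x i)" for i
    by (simp add: g_def block_def vec_eq_iff)
  have "(total_cost f has_derivative (\<lambda>h. \<Sum>i\<in>UNIV. block h i \<bullet> grad (f i) (block x i))) (at x)"
    unfolding total_cost_def[abs_def]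
    by (intro has_derivative_sum has_derivative_compose[OF _
          differentiable_imp_GDERIV_grad[OF f, unfolded gderiv_def]]
        linear_imp_has_derivative linear_block)
  then have tc: "(total_cost f has_derivative (\<lambda>h. h \<bullet> g)) (at x)"
    by (simp add: inner_eq_sum_block[of _ g] bg)
  have "((\<lambda>x. x \<bullet> (S *v x)) has_derivative (\<lambda>h. x \<bullet> (S *v h) + h \<bullet> (S *v x))) (at x)"
    by (intro has_derivative_inner has_derivative_ident linear_imp_has_derivative matrix_vector_mul_linear)
  moreover have "x \<bullet> (S *v h) = h \<bullet> (S *v x)" for h
    using transpose_laplacian[OF W] unfolding S_def
    by (metis dot_lmul_matrix inner_commute transpose_matrix_vector)
  ultimately have "((\<lambda>x. x \<bullet> (S *v x)) has_derivative (\<lambda>h. 2 * (h \<bullet> (S *v x)))) (at x)"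
    by simp
  from has_derivative_add[OF tc has_derivative_mult_right[OF this, of "1 / (2 * \<beta>)"]]
  show ?thesis
    by (simp add: gderiv_def penalty_def[abs_def] inner_add_right g_def S_def laplacian_def)
qed

lemma penalty_grad_has_derivative:
  fixes f :: "'N::finite \<Rightarrow> real^'n::finite \<Rightarrow> real"
  assumes W: "transpose W = W" and f: "\<And>i. twice_continuously_differentiable (f i)"
  shows "(grad (penalty f W \<beta>) has_derivative
    (\<lambda>h. (\<chi> p. (hess (f (fst p)) (block x (fst p)) *v block h (fst p)) $ snd p)
      + (1 / \<beta>) *\<^sub>R (laplacian W *v h))) (at x)"
proof -
  have diff: "f i differentiable (at y)" for i y
    using f by (simp add: twice_continuously_differentiable_def)
  have blockwise: "((\<lambda>x. \<chi> p. grad (f (fst p)) (block x (fst p)) $ snd p) has_derivative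
      (\<lambda>h. \<chi> p. (hess (f (fst p)) (block x (fst p)) *v block h (fst p)) $ snd p)) (at x)"
  proof -
    have "((\<lambda>x. grad (f (fst p)) (block x (fst p)) $ snd p) has_derivative
      (\<lambda>h. (hess (f (fst p)) (block x (fst p)) *v block h (fst p)) $ snd p)) (at x)" for p :: "'N \<times> 'n"
      by (intro bounded_linear.has_derivative[OF bounded_linear_vec_nth]
          has_derivative_compose[OF _ twice_continuously_differentiable_hess[OF f]]
          linear_imp_has_derivative linear_block)
    then show ?thesis
      by (subst has_derivative_componentwise_within)
         (auto simp: Basis_vec_def inner_axis)
  qed
  have "grad (penalty f W \<beta>) =
    (\<lambda>x. (\<chi> p. grad (f (fst p)) (block x (fst p)) $ snd p) + (1 / \<beta>) *\<^sub>R (laplacian W *v x))"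
    by (rule ext, rule grad_eqI, rule penalty_GDERIV[where f = f, OF W diff])
  then show ?thesis
    by (simp only:) (intro has_derivative_add blockwise has_derivative_scaleR_right
        linear_imp_has_derivative matrix_vector_mul_linear)
qed

lemma penalty_hess_mult_vec:
  fixes f :: "'N::finite \<Rightarrow> real^'n::finite \<Rightarrow> real"
  assumes W: "transpose W = W" and f: "\<And>i. twice_continuously_differentiable (f i)"
  shows "hess (penalty f W \<beta>) x *v h =
    (\<chi> p. (hess (f (fst p)) (block x (fst p)) *v block h (fst p)) $ snd p)
      + (1 / \<beta>) *\<^sub>R (laplacian W *v h)"
proof -
  note D = penalty_grad_has_derivative[where f = f, OF W f, where \<beta> = \<beta> and x = x]
  have "grad (penalty f W \<beta>) differentiable (at x)"
    using D by (rule differentiableI)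
  then have "(grad (penalty f W \<beta>) has_derivative (\<lambda>h. hess (penalty f W \<beta>) x *v h)) (at x)"
    unfolding hess_def by (rule iffD1[OF jacobian_works])
  from has_derivative_unique[OF this D] show ?thesis by (rule fun_cong)
qed

text \<open>Blockwise, the Hessian of the sum of the costs dominates \<open>\<mu>\<close>, to which the Laplacian adds a
  nonnegative form. In a difference of two Hessians the Laplacian cancels, and each coordinate
  involves a single block, so the Lipschitz constant of the local costs is kept.\<close>
lemma penalty_smooth_strongly_convex:
  fixes f :: "'N::finite \<Rightarrow> real^'n::finite \<Rightarrow> real"
  assumes W: "weight_matrix E W" and f: "regular_costs f \<mu> M L" and beta: "0 < \<beta>"
  shows "smooth_strongly_convex (penalty f W \<beta>) \<mu> L"
proof -
  have W_sym: "transpose W = W" and ds: "doubly_stochastic W"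
    using W by (auto simp: weight_matrix_def)
  have tcd: "twice_continuously_differentiable (f i)" for i
    using f by (simp add: regular_costs_def)
  then have diff: "f i differentiable (at y)" for i y
    by (simp add: twice_continuously_differentiable_def)
  have mu: "\<mu> * (v \<bullet> v) \<le> v \<bullet> (hess (f i) y *v v)" for i y v
  proof -
    have "positive_definite (hess (f i) y - mat \<mu>)"
      using f by (auto simp: regular_costs_def loewner_less_def)
    then have "0 \<le> v \<bullet> ((hess (f i) y - mat \<mu>) *v v)"
      by (cases "v = 0") (auto simp: positive_definite_def less_imp_le)
    moreover have "mat \<mu> *v v = \<mu> *\<^sub>R v"
      by (simp add: matrix_vector_mult_def mat_def vec_eq_iff if_distrib if_distribR cong: if_cong)
    ultimately show ?thesis by (simp add: matrix_vector_mult_diff_rdistrib inner_diff_right)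
  qed
  note hess = penalty_hess_mult_vec[where f = f, OF W_sym tcd, where \<beta> = \<beta>]
  show ?thesis
  proof
    show "0 < \<mu>" "0 < L" using f by (auto simp: regular_costs_def)
    fix x y v :: "real^('N \<times> 'n)"
    show "GDERIV (penalty f W \<beta>) x :> grad (penalty f W \<beta>) x"
      by (rule differentiable_imp_GDERIV_grad, rule differentiableI,
          rule penalty_GDERIV[where f = f, OF W_sym diff, unfolded gderiv_def])
    show "(grad (penalty f W \<beta>) has_derivative (\<lambda>h. hess (penalty f W \<beta>) x *v h)) (at x)"
      unfolding hess by (rule penalty_grad_has_derivative[where f = f, OF W_sym tcd])
    have "\<mu> * (norm v)\<^sup>2 = (\<Sum>i\<in>UNIV. \<mu> * (block v i \<bullet> block v i))"
      by (simp add: power2_norm_eq_inner inner_eq_sum_block sum_distrib_left)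
    also have "\<dots> \<le> (\<Sum>i\<in>UNIV. block v i \<bullet> (hess (f i) (block x i) *v block v i))"
      by (intro sum_mono mu)
    also have "\<dots> = v \<bullet> (\<chi> p. (hess (f (fst p)) (block x (fst p)) *v block v (fst p)) $ snd p)"
      unfolding inner_eq_sum_block by (intro sum.cong refl arg_cong2[of _ _ _ _ inner])
        (simp add: block_def[of "vec_lambda _"] vec_eq_iff)
    also have "\<dots> \<le> v \<bullet> (hess (penalty f W \<beta>) x *v v)"
      using laplacian_nonneg[OF ds, of v] beta by (simp add: hess inner_add_right)
    finally show "\<mu> * (norm v)\<^sup>2 \<le> v \<bullet> (hess (penalty f W \<beta>) x *v v)" .
    show "infnorm (hess (penalty f W \<beta>) x *v v - hess (penalty f W \<beta>) y *v v)
        \<le> L * infnorm (x - y) * infnorm v"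
    proof (rule infnorm_le_cartI)
      fix p :: "'N \<times> 'n"
      obtain i a where p: "p = (i, a)" by (cases p)
      define A where "A = hess (f i) (block x i) - hess (f i) (block y i)"
      have "\<bar>(hess (penalty f W \<beta>) x *v v - hess (penalty f W \<beta>) y *v v) $ p\<bar> = \<bar>(A *v block v i) $ a\<bar>"
        by (simp add: hess p A_def matrix_vector_mult_diff_rdistrib)
      also have "\<dots> \<le> op_infnorm A * infnorm (block v i)"
        by (rule order_trans[OF component_le_infnorm_cart infnorm_mult_vec_le_op_infnorm])
      also have "\<dots> \<le> (L * infnorm (block x i - block y i)) * infnorm (block v i)"
        using f by (intro mult_right_mono infnorm_pos_le) (simp add: regular_costs_def A_def)
      also have "\<dots> \<le> (L * infnorm (x - y)) * infnorm v"
        using f infnorm_block_le[of "x - y" i] infnorm_block_le[of v i]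
        by (intro mult_mono mult_nonneg_nonneg infnorm_pos_le mult_left_mono)
           (auto simp: regular_costs_def block_diff)
      finally show "\<bar>(hess (penalty f W \<beta>) x *v v - hess (penalty f W \<beta>) y *v v) $ p\<bar>
        \<le> L * infnorm (x - y) * infnorm v" .
    qed
  qed
qed

theorem theorem4p2:
  fixes E :: "('N::finite \<times> 'N) set"
    and W :: "real^'N^'N"
    and f :: "'N \<Rightarrow> real^'n::finite \<Rightarrow> real"
    and \<mu> M L \<beta> :: real
  assumes A1: "network E"
    and A2: "weight_matrix E W"
    and A3: "regular_costs f \<mu> M L"
    and beta: "\<beta> > 0"
  shows "\<exists>xs. unique_minimizer (penalty f W \<beta>) xs \<and>
    (\<exists>\<eta>\<^sub>t\<^sub>h\<^sub>r>0. \<forall>\<gamma>\<^sub>0 q \<eta> x \<eta>\<^sub>b\<^sub>a\<^sub>r.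
        dinas (penalty f W \<beta>) \<gamma>\<^sub>0 q \<eta> x \<longrightarrow>
        decseq \<eta> \<longrightarrow>
        0 < \<eta>\<^sub>b\<^sub>a\<^sub>r \<longrightarrow> \<eta>\<^sub>b\<^sub>a\<^sub>r < \<eta>\<^sub>t\<^sub>h\<^sub>r \<longrightarrow>
        (\<forall>k. \<eta> k \<le> \<eta>\<^sub>b\<^sub>a\<^sub>r) \<longrightarrow>
        converges_linearly x xs) \<and>
    (\<forall>\<gamma>\<^sub>0 q \<eta> x \<eta>\<^sub>c \<delta>.
        dinas (penalty f W \<beta>) \<gamma>\<^sub>0 q \<eta> x \<longrightarrow>
        0 \<le> \<eta>\<^sub>c \<longrightarrow>
        (\<forall>\<^sub>F k in sequentially. \<eta> k \<le> \<eta>\<^sub>c * infnorm (grad (penalty f W \<beta>) (x k)) powr \<delta>) \<longrightarrow>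
        (0 < \<delta> \<and> \<delta> < 1 \<longrightarrow> converges_superlinearly x xs) \<and>
        (\<delta> = 1 \<longrightarrow> converges_quadratically x xs))"
proof -
  interpret smooth_strongly_convex "penalty f W \<beta>" \<mu> L
    by (rule penalty_smooth_strongly_convex[OF A2 A3 beta])
  obtain xs where xs: "grad (penalty f W \<beta>) xs = 0" using ex_stationary by blast
  obtain \<theta> where \<theta>: "0 < \<theta>" and linear: "\<And>\<gamma>\<^sub>0 q \<eta> x.
      dinas (penalty f W \<beta>) \<gamma>\<^sub>0 q \<eta> x \<Longrightarrow> \<forall>k. \<eta> k \<le> \<theta> \<Longrightarrow> converges_linearly x xs"
    using dinas_linear[OF xs] by blast
  show ?thesis
  proof (intro exI[of _ xs] exI[of _ \<theta>] conjI allI impI)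
    show "unique_minimizer (penalty f W \<beta>) xs" by (rule stationary_unique_minimizer[OF xs])
    show "0 < \<theta>" by (rule \<theta>)
  next
    fix \<gamma>\<^sub>0 q \<eta> x \<eta>\<^sub>b\<^sub>a\<^sub>r
    assume "dinas (penalty f W \<beta>) \<gamma>\<^sub>0 q \<eta> x" "\<eta>\<^sub>b\<^sub>a\<^sub>r < \<theta>" "\<forall>k. \<eta> k \<le> \<eta>\<^sub>b\<^sub>a\<^sub>r"
    then show "converges_linearly x xs"
      by (meson linear less_imp_le order_trans)
  next
    fix \<gamma>\<^sub>0 q \<eta> x \<eta>\<^sub>c \<delta>
    assume din: "dinas (penalty f W \<beta>) \<gamma>\<^sub>0 q \<eta> x" and c: "0 \<le> \<eta>\<^sub>c"
      and forcing: "\<forall>\<^sub>F k in sequentially. \<eta> k \<le> \<eta>\<^sub>c * infnorm (grad (penalty f W \<beta>) (x k)) powr \<delta>"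
    show "converges_superlinearly x xs" if "0 < \<delta> \<and> \<delta> < 1"
      using dinas_superlinear[OF xs din _ forcing] that by blast
    show "converges_quadratically x xs" if "\<delta> = 1"
      using dinas_quadratic[OF xs din c] forcing that by (simp add: infnorm_pos_le)
  qed
qed

end
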